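(* 1) For every complex $x$ that is not a non-positive integer and every integer $n\ge 1$, $$\frac{1}{(x)^{(n)}}=\frac{1}{(n-1)!}\sum_{j=0}^{n-1}\binom{n-1}{j}\frac{(-1)^j}{x+j}.$$ 2) For every complex $x\neq 1$ that is not a non-positive integer and every integer $n\ge 0$, $$\sum_{j=0}^n(-1)^j\binom{n}{j}\frac{x+2j-1}{(x+j-1)^{(n+1)}}=\delta_{n,0},$$ $$\sum_{j=0}^n(-1)^j\binom{n}{j}\frac{1}{(x+j-1)^{(j)}\,(x+2j)^{(n-j)}}=\delta_{n,0}.$$ 3) For all complex $x,y$ whose sum is not an integer less than or equal to $1$ and every integer $n\ge 0$, $$1=\sum_{j=0}^n\binom{n}{j}\frac{(x+j)^{(n-j)}\,(y)^{(j)}}{(y+x+j-1)^{(j)}\,(y+x+2j)^{(n-j)}}.$$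
   Context: Rising factorial: $(x)^{(n)}=x(x+1)\cdots(x+n-1)$, $(x)^{(0)}=1$. $\delta_{n,0}$ is the Kronecker delta. *)

theory Defs
  imports Complex_Main "HOL-Library.Nonpos_Ints"
begin

end

theory Submission
  imports Defs
begin

text \<open>
  The first identity is the iterated difference \<open>f(x) - f(x + 1)\<close> applied to \<open>1 / x\<close>. The two sums of
  the second part agree termwise, and the first one is Gosper-summable: its partial sums are
  \<open>(-1)^m binom(n-1, m) / (x+m)^(n)\<close>. The third identity is a Wilf-Zeilberger sum: the difference of
  the summands for \<open>n + 1\<close> and \<open>n\<close> telescopes in \<open>j\<close>.
\<close>

section \<open>Iterated differences of 1/x\<close>

text \<open>Pascal's rule: the \<open>n choose j\<close> share of each coefficient rebuilds the sum
  for \<open>f\<close>, while the other share, after an index shift that costs a sign, gives the sum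
  for the shifted sequence.\<close>

lemma sum_choose_alternating_Suc:
  fixes f :: "nat \<Rightarrow> 'a :: comm_ring_1"
  shows "(\<Sum>j\<le>Suc n. of_nat (Suc n choose j) * ((-1) ^ j * f j))
    = (\<Sum>j\<le>n. of_nat (n choose j) * ((-1) ^ j * f j))
      - (\<Sum>j\<le>n. of_nat (n choose j) * ((-1) ^ j * f (Suc j)))"
proof -
  have "(\<Sum>j\<le>Suc n. of_nat (Suc n choose j) * ((-1) ^ j * f j))
      = f 0 + (\<Sum>j\<le>n. of_nat (n choose Suc j) * ((-1) ^ Suc j * f (Suc j)))
        - (\<Sum>j\<le>n. of_nat (n choose j) * ((-1) ^ j * f (Suc j)))"
    by (subst sum.atMost_Suc_shift) (simp add: algebra_simps sum.distrib sum_subtractf sum_negf)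
  \<comment> \<open>The term at 0 is reattached; the range may end at \<open>Suc n\<close> because
    \<open>n choose Suc n\<close> is 0.\<close>
  also have "f 0 + (\<Sum>j\<le>n. of_nat (n choose Suc j) * ((-1) ^ Suc j * f (Suc j)))
      = (\<Sum>j\<le>Suc n. of_nat (n choose j) * ((-1) ^ j * f j))"
    by (subst sum.atMost_Suc_shift) simp
  finally show ?thesis
    by (simp add: binomial_eq_0)
qed

lemma pochhammer_nonzero:
  fixes x :: "'a :: field_char_0"
  assumes "\<And>k. x + of_nat k \<noteq> 0"
  shows "pochhammer x n \<noteq> 0"
  using assms by (auto simp: pochhammer_prod)

text \<open>Shifting the sequence replaces \<open>x\<close> by \<open>x + 1\<close>, hence the
  induction with \<open>x\<close> arbitrary. Over the common denominator the two closed forms differ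
  by \<open>fact n\<close> times (x + n + 1) - x = n + 1, which yields
  \<open>fact (Suc n)\<close>.\<close>

lemma sum_choose_alternating_inverse:
  fixes x :: "'a :: field_char_0"
  assumes "\<And>k. x + of_nat k \<noteq> 0"
  shows "(\<Sum>j\<le>n. of_nat (n choose j) * ((-1) ^ j * (1 / (x + of_nat j)))) = fact n / pochhammer x (Suc n)"
  using assms
proof (induction n arbitrary: x)
  case 0
  then show ?case
    by simp
next
  case (Suc n)
  have shift: "x + 1 + of_nat k \<noteq> 0" for k
    using Suc.prems[of "Suc k"] by (simp add: algebra_simps)
  define P where "P = pochhammer (x + 1) n"
  have nz: "x \<noteq> 0" "P \<noteq> 0" "x + 1 + of_nat n \<noteq> 0"
    using Suc.prems[of 0] shift pochhammer_nonzero[of "x + 1" n] by (auto simp: P_def)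
  have P: "pochhammer x (Suc n) = x * P" "pochhammer (x + 1) (Suc n) = P * (x + 1 + of_nat n)"
    "pochhammer x (Suc (Suc n)) = x * (P * (x + 1 + of_nat n))"
    by (simp_all add: P_def pochhammer_rec[of x] pochhammer_Suc[of "x + 1"])
  have "(\<Sum>j\<le>Suc n. of_nat (Suc n choose j) * ((-1) ^ j * (1 / (x + of_nat j))))
      = fact n / pochhammer x (Suc n) - fact n / pochhammer (x + 1) (Suc n)"
    using Suc.IH[OF Suc.prems] Suc.IH[OF shift]
    by (subst sum_choose_alternating_Suc) (simp add: add.assoc)
  also have "\<dots> = fact (Suc n) / pochhammer x (Suc (Suc n))"
    unfolding P using nz by (simp add: divide_simps) (simp add: algebra_simps)
  finally show ?case .
qed

section \<open>Gosper summation for the second part\<close>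

text \<open>Absorption with denominators cleared and subtraction taken in the ring, so that
  \<open>algebra\<close> can use it as a polynomial relation between neighbouring binomial
  coefficients.\<close>

lemma choose_Suc_mult:
  "of_nat (n choose Suc j) * (of_nat j + 1) = (of_nat (n choose j) * (of_nat n - of_nat j) :: 'a :: comm_ring_1)"
proof (cases "j \<le> n")
  case True
  have "(n choose Suc j) * Suc j = (n choose j) * (n - j)"
    by (metis binomial_absorb_comp binomial_absorption mult.commute)
  then have "of_nat ((n choose Suc j) * Suc j) = (of_nat ((n choose j) * (n - j)) :: 'a)"
    by simp
  with True show ?thesis
    by (simp add: of_nat_diff algebra_simps)
qed (simp add: binomial_eq_0)

lemma Gosper_partial_sum:
  fixes x :: "'a :: field_char_0"
  assumes "\<And>k. x - 1 + of_nat k \<noteq> 0"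
  shows "(\<Sum>j\<le>m. (-1) ^ j * of_nat (Suc n choose j)
      * ((x + 2 * of_nat j - 1) / pochhammer (x + of_nat j - 1) (Suc (Suc n))))
    = (-1) ^ m * of_nat (n choose m) / pochhammer (x + of_nat m) (Suc n)"
proof (induction m)
  case 0
  then show ?case
    using assms[of 0] by (simp add: pochhammer_rec[of "x - 1"])
next
  case (Suc m)
  define z where "z = x + of_nat m"
  define P where "P = pochhammer (z + 1) n"
  have z: "z + of_nat k \<noteq> 0" for k
    using assms[of "Suc (m + k)"] by (simp add: z_def algebra_simps)
  have z1: "z + 1 + of_nat k \<noteq> 0" for k
    using z[of "Suc k"] by (simp add: algebra_simps)
  have nz: "z \<noteq> 0" "P \<noteq> 0" "z + 1 + of_nat n \<noteq> 0"
    using z[of 0] z1 pochhammer_nonzero[of "z + 1" n] by (auto simp: P_def)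
  have P: "pochhammer z (Suc n) = z * P" "pochhammer (z + 1) (Suc n) = P * (z + 1 + of_nat n)"
    "pochhammer z (Suc (Suc n)) = z * (P * (z + 1 + of_nat n))"
    by (simp_all add: P_def pochhammer_rec[of z] pochhammer_Suc[of "z + 1"])
  have args: "z + 1 - 1 = z" "x + of_nat (Suc m) = z + 1"
    "x + 2 * of_nat (Suc m) - 1 = z + of_nat m + 1"
    by (simp_all add: z_def)
  define A B where "A = (of_nat (n choose m) :: 'a)" and "B = (of_nat (n choose Suc m) :: 'a)"
  have AB: "B * (of_nat m + 1) = A * (of_nat n - of_nat m)"
    unfolding A_def B_def by (rule choose_Suc_mult)
  \<comment> \<open>This is the induction step with the common denominator
    \<open>z * (P * (z + 1 + of_nat n))\<close> cleared; the two sides differ by exactly the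
    absorption relation \<open>AB\<close>.\<close>
  have "(A + B) * (z + of_nat m + 1) = A * (z + 1 + of_nat n) + B * z"
    using AB by algebra
  then have "A / (z * P) - (A + B) * ((z + of_nat m + 1) / (z * (P * (z + 1 + of_nat n))))
      = - (B / (P * (z + 1 + of_nat n)))"
    using nz by (simp add: divide_simps)
  then have "(-1) ^ m * (A / (z * P) - (A + B) * ((z + of_nat m + 1) / (z * (P * (z + 1 + of_nat n)))))
      = (-1) ^ m * - (B / (P * (z + 1 + of_nat n)))"
    by (rule arg_cong)
  then have "(-1) ^ m * A / (z * P)
      + (-1) ^ Suc m * (A + B) * ((z + of_nat m + 1) / (z * (P * (z + 1 + of_nat n))))
      = (-1) ^ Suc m * B / (P * (z + 1 + of_nat n))"
    by (simp add: right_diff_distrib mult.assoc)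
  moreover have "of_nat (Suc n choose Suc m) = A + B"
    by (simp add: A_def B_def)
  ultimately show ?case
    unfolding sum.atMost_Suc Suc.IH args P
    unfolding z_def[symmetric] P A_def[symmetric] B_def[symmetric] by simp
qed

lemma sum_choose_alternating_pochhammer:
  fixes x :: "'a :: field_char_0"
  assumes "\<And>k. x - 1 + of_nat k \<noteq> 0"
  shows "(\<Sum>j\<le>n. (-1) ^ j * of_nat (n choose j)
      * ((x + 2 * of_nat j - 1) / pochhammer (x + of_nat j - 1) (n + 1))) = (if n = 0 then 1 else 0)"
proof (cases n)
  case 0
  then show ?thesis
    using assms[of 0] by simp
next
  case (Suc k)
  \<comment> \<open>At \<open>m = Suc k\<close> the closed form carries the factor
    \<open>k choose Suc k\<close>, which is 0.\<close>
  then show ?thesis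
    using Gosper_partial_sum[OF assms, where m = "Suc k" and n = k] by simp
qed

section \<open>Rewriting the denominators as one rising factorial\<close>

text \<open>The \<open>n + 1\<close> factors run from s + j - 1 to s + j + n - 1. The first
  \<open>j\<close> end at s + 2j - 2, the next one is s + 2j - 1, and \<open>n - j\<close>
  remain.\<close>

lemma pochhammer_split:
  fixes s :: "'a :: field_char_0"
  assumes "j \<le> n"
  shows "pochhammer (s + of_nat j - 1) (n + 1)
    = pochhammer (s + of_nat j - 1) j * (s + 2 * of_nat j - 1) * pochhammer (s + 2 * of_nat j) (n - j)"
proof -
  have "pochhammer (s + of_nat j - 1) (n + 1)
      = pochhammer (s + of_nat j - 1) j * pochhammer (s + of_nat j - 1 + of_nat j) (Suc (n - j))"
    using assms by (subst pochhammer_product[of j]) (simp_all add: Suc_diff_le)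
  also have "s + of_nat j - 1 + of_nat j = s + 2 * of_nat j - 1"
    by simp
  also have "pochhammer (s + 2 * of_nat j - 1) (Suc (n - j))
      = (s + 2 * of_nat j - 1) * pochhammer (s + 2 * of_nat j) (n - j)"
    by (simp add: pochhammer_rec)
  finally show ?thesis
    by (simp add: mult.assoc)
qed

text \<open>Restores the missing middle factor of the denominator, which is nonzero by the
  assumption at k = 2j. The numerator \<open>c\<close> is free so that the second and third parts
  can share the rewriting.\<close>

lemma divide_pochhammer_split:
  fixes s :: "'a :: field_char_0"
  assumes "\<And>k. s - 1 + of_nat k \<noteq> 0" "j \<le> n"
  shows "c / (pochhammer (s + of_nat j - 1) j * pochhammer (s + 2 * of_nat j) (n - j))
    = c * (s + 2 * of_nat j - 1) / pochhammer (s + of_nat j - 1) (n + 1)"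
proof -
  have "s + 2 * of_nat j - 1 \<noteq> 0"
    using assms(1)[of "2 * j"] by (simp add: algebra_simps)
  then show ?thesis
    unfolding pochhammer_split[OF assms(2)] by simp
qed

section \<open>Wilf-Zeilberger summation for the third part\<close>

text \<open>The right-hand side is the Wilf-Zeilberger mate of \<open>F\<close>, checked by
  induction on \<open>m\<close>. Keeping \<open>s\<close> as a variable leaves the denominators
  compact; \<open>s = y + x\<close> enters only in the polynomial identities.\<close>

lemma WZ_partial_sum:
  fixes x y s :: "'a :: field_char_0"
  defines "F \<equiv> \<lambda>n j. of_nat (n choose j) * (pochhammer (x + of_nat j) (n - j) * pochhammer y j
      * (s + 2 * of_nat j - 1) / pochhammer (s + of_nat j - 1) (n + 1))"
  assumes nz: "\<And>k. s - 1 + of_nat k \<noteq> 0" and s: "s = y + x" and "m \<le> n"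
  shows "(\<Sum>j\<le>m. F (Suc n) j) - (\<Sum>j\<le>m. F n j)
    = - (of_nat (n choose m) * (pochhammer y (Suc m) * pochhammer (x + of_nat m) (n - m)
        / pochhammer (s + of_nat m) (Suc n)))"
  using \<open>m \<le> n\<close>
proof (induction m)
  case 0
  have s0: "s + of_nat k \<noteq> 0" for k
    using nz[of "Suc k"] by (simp add: algebra_simps)
  have "pochhammer s n \<noteq> 0" "s + of_nat n \<noteq> 0" "s - 1 \<noteq> 0"
    using pochhammer_nonzero[of s n] s0 nz[of 0] by auto
  then show ?case
    by (simp add: F_def pochhammer_rec[of "s - 1"] pochhammer_Suc[of s] pochhammer_Suc[of x] divide_simps)
      (simp add: s algebra_simps)
next
  case (Suc m)
  \<comment> \<open>With \<open>d\<close> equal to n - m - 1, each rising factorial in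
    \<open>x\<close> below is \<open>X\<close> up to at most one linear factor.\<close>
  then obtain d where d: "n = Suc (m + d)"
    using less_iff_Suc_add[of m n] by auto
  define z where "z = s + of_nat m"
  define P where "P = pochhammer (z + 1) n"
  define X where "X = pochhammer (x + of_nat m + 1) d"
  define Y where "Y = pochhammer y (Suc m)"
  have z: "z + of_nat k \<noteq> 0" for k
    using nz[of "Suc (m + k)"] by (simp add: z_def algebra_simps)
  have z1: "z + 1 + of_nat k \<noteq> 0" for k
    using z[of "Suc k"] by (simp add: algebra_simps)
  have nzs: "z \<noteq> 0" "P \<noteq> 0" "z + 1 + of_nat n \<noteq> 0"
    using z[of 0] z1 pochhammer_nonzero[of "z + 1" n] by (auto simp: P_def)
  have P: "pochhammer z (Suc n) = z * P" "pochhammer (z + 1) (Suc n) = P * (z + 1 + of_nat n)"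
    "pochhammer z (Suc (Suc n)) = z * (P * (z + 1 + of_nat n))"
    by (simp_all add: P_def pochhammer_rec[of z] pochhammer_Suc[of "z + 1"])
  have args: "z + 1 - 1 = z" "s + of_nat (Suc m) = z + 1"
    "s + 2 * of_nat (Suc m) - 1 = z + of_nat m + 1" "x + of_nat (Suc m) = x + of_nat m + 1"
    by (simp_all add: z_def)
  have X: "pochhammer (x + of_nat m) (n - m) = (x + of_nat m) * X"
    "pochhammer (x + of_nat m + 1) (Suc n - Suc m) = X * (x + of_nat n)"
    "pochhammer (x + of_nat m + 1) (n - Suc m) = X"
    by (simp_all add: d X_def pochhammer_rec[of "x + of_nat m"] pochhammer_Suc[of "x + of_nat m + 1"] Suc_diff_le)
  have Y: "pochhammer y (Suc (Suc m)) = Y * (y + of_nat m + 1)"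
    by (simp add: Y_def pochhammer_Suc[of y "Suc m"] add_ac)
  define A B where "A = (of_nat (n choose m) :: 'a)" and "B = (of_nat (n choose Suc m) :: 'a)"
  have AB: "B * (of_nat m + 1) = A * (of_nat n - of_nat m)"
    unfolding A_def B_def by (rule choose_Suc_mult)
  have zs: "z = y + x + of_nat m"
    by (simp add: z_def s)
  \<comment> \<open>The telescoping relation stripped of \<open>X * Y\<close> and of its
    denominators: the increment of \<open>F\<close> on the left, the difference of the boundary
    terms at \<open>m\<close> and \<open>Suc m\<close> on the right.\<close>
  have key: "(A + B) * (x + of_nat n) * (z + of_nat m + 1) - B * (z + of_nat m + 1) * (z + 1 + of_nat n)
      = A * (x + of_nat m) * (z + 1 + of_nat n) - B * (y + of_nat m + 1) * z"
    using AB zs by algebra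
  have "F (Suc n) (Suc m) - F n (Suc m)
      = X * Y * ((A + B) * (x + of_nat n) * (z + of_nat m + 1)
          - B * (z + of_nat m + 1) * (z + 1 + of_nat n)) / (z * P * (z + 1 + of_nat n))"
    unfolding F_def args Suc_eq_plus1[symmetric]
    unfolding P X Y_def[symmetric] binomial_Suc_Suc of_nat_add
      A_def[symmetric] B_def[symmetric]
    using nzs by (simp add: divide_simps) (simp add: algebra_simps)
  also have "\<dots> = A * (Y * ((x + of_nat m) * X) / (z * P))
      - B * (Y * (y + of_nat m + 1) * X / (P * (z + 1 + of_nat n)))"
    unfolding key using nzs by (simp add: divide_simps) (simp add: algebra_simps)
  finally have step: "F (Suc n) (Suc m) - F n (Suc m) = \<dots>" .
  have IH: "(\<Sum>j\<le>m. F (Suc n) j) - (\<Sum>j\<le>m. F n j) = - (A * (Y * ((x + of_nat m) * X) / (z * P)))"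
    using Suc.IH Suc.prems unfolding X z_def[symmetric] P A_def Y_def by simp
  show ?case
    unfolding args X Y P sum.atMost_Suc B_def[symmetric] add_diff_add step IH
    by simp
qed

text \<open>Passing from \<open>n\<close> to \<open>Suc n\<close> changes the terms up to
  \<open>n\<close> by the boundary value at \<open>m = n\<close>, and the new term j = n + 1 cancels
  exactly that.\<close>

lemma sum_choose_pochhammer_eq_1:
  fixes x y s :: "'a :: field_char_0"
  assumes nz: "\<And>k. s - 1 + of_nat k \<noteq> 0" and s: "s = y + x"
  shows "(\<Sum>j\<le>n. of_nat (n choose j) * (pochhammer (x + of_nat j) (n - j) * pochhammer y j
      * (s + 2 * of_nat j - 1) / pochhammer (s + of_nat j - 1) (n + 1))) = 1"
proof (induction n)
  case 0
  then show ?case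
    using nz[of 0] by simp
next
  case (Suc n)
  let ?z = "s + of_nat n"
  have z: "?z + of_nat k \<noteq> 0" for k
    using nz[of "Suc (n + k)"] by (simp add: algebra_simps)
  have "pochhammer ?z (Suc n) \<noteq> 0" "?z + of_nat n + 1 \<noteq> 0"
    using pochhammer_nonzero[OF z] z[of "Suc n"] by (auto simp: add_ac)
  moreover have "pochhammer ?z (Suc (Suc n)) = pochhammer ?z (Suc n) * (?z + of_nat n + 1)"
    by (simp add: pochhammer_Suc[of _ "Suc n"] add_ac)
  moreover have "s + 2 * of_nat (Suc n) - 1 = ?z + of_nat n + 1" "s + of_nat (Suc n) - 1 = ?z"
    by simp_all
  \<comment> \<open>The numerator s + 2n + 1 is the final factor of the denominator.\<close>
  ultimately have last: "(s + 2 * of_nat (Suc n) - 1) / pochhammer (s + of_nat (Suc n) - 1) (Suc (Suc n))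
      = 1 / pochhammer ?z (Suc n)"
    by (simp only: nonzero_divide_mult_cancel_right not_False_eq_True)
  show ?case
    using WZ_partial_sum[OF nz s order.refl, of n] Suc.IH last
    by (simp add: diff_eq_eq of_nat_Suc[of 0] del: of_nat_Suc flip: times_divide_eq_right) simp
qed

theorem lemma1:
  "(\<forall>(x::complex) (n::nat). x \<notin> \<int>\<^sub>\<le>\<^sub>0 \<longrightarrow> n \<ge> 1 \<longrightarrow>
      1 / pochhammer x n
        = 1 / fact (n - 1) * (\<Sum>j=0..n-1. of_nat ((n - 1) choose j) * ((-1) ^ j / (x + of_nat j))))
   \<and>
   (\<forall>(x::complex) (n::nat). x \<noteq> 1 \<longrightarrow> x \<notin> \<int>\<^sub>\<le>\<^sub>0 \<longrightarrow>
      (\<Sum>j=0..n. (-1) ^ j * of_nat (n choose j)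
          * ((x + 2 * of_nat j - 1) / pochhammer (x + of_nat j - 1) (n + 1)))
        = (if n = 0 then 1 else 0)
      \<and>
      (\<Sum>j=0..n. (-1) ^ j * of_nat (n choose j)
          * (1 / (pochhammer (x + of_nat j - 1) j * pochhammer (x + 2 * of_nat j) (n - j))))
        = (if n = 0 then 1 else 0))
   \<and>
   (\<forall>(x::complex) (y::complex) (n::nat). (\<forall>k::int. k \<le> 1 \<longrightarrow> x + y \<noteq> of_int k) \<longrightarrow>
      1 = (\<Sum>j=0..n. of_nat (n choose j)
          * ((pochhammer (x + of_nat j) (n - j) * pochhammer y j)
             / (pochhammer (y + x + of_nat j - 1) j * pochhammer (y + x + 2 * of_nat j) (n - j)))))"
proof (intro conjI allI impI)
  fix x :: complex and n :: nat
  assume x: "x \<notin> \<int>\<^sub>\<le>\<^sub>0" and n: "n \<ge> 1"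
  have "x + of_nat k \<noteq> 0" for k
    using x by (metis add_eq_0_iff2 minus_of_nat_in_nonpos_Ints)
  from sum_choose_alternating_inverse[OF this, of "n - 1"] n
  show "1 / pochhammer x n
      = 1 / fact (n - 1) * (\<Sum>j=0..n-1. of_nat ((n - 1) choose j) * ((-1) ^ j / (x + of_nat j)))"
    by (simp add: atMost_atLeast0)
next
  fix x :: complex and n :: nat
  assume x1: "x \<noteq> 1" and x: "x \<notin> \<int>\<^sub>\<le>\<^sub>0"
  \<comment> \<open>The case k = 0 is \<open>x \<noteq> 1\<close>; the case k = l + 1 says that
    \<open>x\<close> is not -l.\<close>
  have nz: "x - 1 + of_nat k \<noteq> 0" for k
  proof (cases k)
    case 0
    then show ?thesis
      using x1 by simp
  next
    case (Suc l)
    then show ?thesis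
      using x minus_of_nat_in_nonpos_Ints[of l, where ?'a = complex] by (auto simp: add_eq_0_iff2)
  qed
  show *: "(\<Sum>j=0..n. (-1) ^ j * of_nat (n choose j)
          * ((x + 2 * of_nat j - 1) / pochhammer (x + of_nat j - 1) (n + 1)))
        = (if n = 0 then 1 else 0)"
    using sum_choose_alternating_pochhammer[OF nz] by (simp add: atMost_atLeast0)
  show "(\<Sum>j=0..n. (-1) ^ j * of_nat (n choose j)
          * (1 / (pochhammer (x + of_nat j - 1) j * pochhammer (x + 2 * of_nat j) (n - j))))
        = (if n = 0 then 1 else 0)"
    \<comment> \<open>The right-hand side is turned back into the first sum, and the two sums are
      compared term by term.\<close>
    unfolding *[symmetric]
    by (intro sum.cong refl, subst divide_pochhammer_split[OF nz]) simp_all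
next
  fix x y :: complex and n :: nat
  assume xy: "\<forall>k::int. k \<le> 1 \<longrightarrow> x + y \<noteq> of_int k"
  have nz: "y + x - 1 + of_nat k \<noteq> 0" for k
    \<comment> \<open>A zero would make \<open>x + y\<close> equal to 1 - k, an excluded
      integer.\<close>
    using xy[rule_format, of "1 - int k"] by (auto simp: algebra_simps)
  have "(\<Sum>j=0..n. of_nat (n choose j)
          * ((pochhammer (x + of_nat j) (n - j) * pochhammer y j)
             / (pochhammer (y + x + of_nat j - 1) j * pochhammer (y + x + 2 * of_nat j) (n - j))))
      = (\<Sum>j\<le>n. of_nat (n choose j) * (pochhammer (x + of_nat j) (n - j) * pochhammer y j
      * (y + x + 2 * of_nat j - 1) / pochhammer (y + x + of_nat j - 1) (n + 1)))"
    unfolding atMost_atLeast0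
    by (intro sum.cong refl, subst divide_pochhammer_split[OF nz]) simp_all
  also have "\<dots> = 1"
    by (rule sum_choose_pochhammer_eq_1[OF nz refl])
  finally show "1 = (\<Sum>j=0..n. of_nat (n choose j)
          * ((pochhammer (x + of_nat j) (n - j) * pochhammer y j)
             / (pochhammer (y + x + of_nat j - 1) j * pochhammer (y + x + 2 * of_nat j) (n - j))))"
    by (rule sym)
qed

end
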